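(* Let $A=(a_{ij})$ be an $n\times n$ square matrix. Then $A$ is semigraphical if and only if it satisfies both of the following conditions. (1) $a_{ij}\in\{0,\tfrac14,\tfrac12,1,2,\dots,n-1\}$ and $a_{ij}=a_{ji}$ for all $i,j$, and $a_{ii}=0$ for all $i$. (2) Let $X=\{1,2,\dots,n\}$ be the indexing set of the rows and columns of $A$. There are subsets $e_1,\dots,e_m$ of $X$ with $X=\bigcup_{i=1}^m e_i$, $|e_i|\ge 2$ for all $i$, and $|e_i\cap e_j|\le 1$ for all $i\ne j$, such that, for each $i$, the submatrix $A_i$ of $A$ with rows and columns indexed by $e_i$ is, up to a permutation of the indices, an edge submatrix (as defined in the context).
   Context: A semigraph is a pair $G=(V,E)$, where $V$ is a non-empty finite set (vertices) and $E$ is a set of ordered $k$-tuples ($k\ge 2$, $k$ may vary) of distinct vertices (edges), such that any two distinct edges have at most one vertex in common; an edge $(u_1,\dots,u_k)$ is identified with its reversal $(u_k,\dots,u_1)$. Standing assumption of the paper: semigraphs are connected, i.e. for any two vertices $u,v$ there is a sequence of edges $e_{i_1},\dots,e_{i_p}$ with $u\in e_{i_1}$, $v\in e_{i_p}$ and $|e_{i_j}\cap e_{i_{j+1}}|=1$ for $1\le j\le p-1$. For an edge $(u_1,\dots,u_k)$, $u_1,u_k$ are its end vertices and $u_2,\dots,u_{k-1}$ its middle vertices. A vertex is a pure end vertex if it is an end vertex of every edge containing it; a pure middle vertex if it is a middle vertex of every edge containing it; a middle end vertex if it is a middle vertex of at least one edge and an end vertex of at least one other edge. An edge $(u_1,\dots,u_k)$,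 $k\ge2$, is a full edge if $u_1,u_k$ are pure end vertices. An edge with $k>2$ is a half edge if at least one of $u_1,u_k$ is a middle end vertex. An edge $(u_1,u_2)$ with two vertices is a quarter edge if both are middle end vertices, and a half edge if exactly one is a middle end vertex and the other is a pure end vertex. For a half edge $(u_1,\dots,u_k)$ with $k>2$, the pair $(u_1,u_2)$ is a partial half edge if $u_1$ is a middle end vertex, and $(u_{k-1},u_k)$ is a partial half edge if $u_k$ is a middle end vertex; a half edge with two vertices is itself a partial half edge. For vertices $u_i,u_j$ of an edge $e=(u_1,\dots,u_k)$ put $d_e(u_i,u_j)=|i-j|$. The adjacency matrix of a semigraph with vertices $v_1,\dots,v_n$ is the $n\times n$ matrix $(a_{ij})$ with: $a_{ij}=d_e(v_i,v_j)$ if $v_i\neq v_j$ belong to a full edge or half edge $e$ and $(v_i,v_j)$ is neither a partial half edge nor a quarter edge; $a_{ij}=\frac12$ if $(v_i,v_j)$ is a partial half edge; $a_{ij}=\frac14$ if $(v_i,v_j)$ is a quarter edge; $a_{ij}=0$ otherwise. A matrix $A$ is semigraphical if there exists a semigraph whose adjacency matrix is $A$. Edge submatrix: for an edge $e$ listed as $(u_1,\dots,u_r)$, $r\ge2$, which is not a quarter edge, it is the symmetric $r\times r$ matrix with zero diagonal whose $(p,q)$ entry is $|p-q|$ for $p\neq q$, except that the entries at positions $(1,2),(2,1)$ equal $\mu_1$ and those at positions $(r-1,r),(r,r-1)$ equal $\mu_2$, where $\mu_1=1$ if $u_1$ is a pure end vertex and $\mu_1=\frac12$ if $u_1$ is a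 middle end vertex, and likewise $\mu_2=1$ or $\frac12$ according as $u_r$ is a pure end vertex or a middle end vertex (for $r=2$ the single off-diagonal value is $1$ if both vertices are pure end vertices and $\frac12$ if exactly one is a middle end vertex). For a quarter edge it is $\begin{pmatrix}0&\frac14\\ \frac14&0\end{pmatrix}$. In condition (2), each $e_i$ is ordered according to the permutation of indices used, and the terms pure end vertex, middle end vertex and quarter edge refer to the resulting family of ordered tuples $e_1,\dots,e_m$ on $X$.
   Formalization: Condition (2) as proved also requires that the ordered edges e_1,…,e_m form a connected semigraph on X and that a_ij = 0 whenever i, j lie in no common e_k; without either requirement the "if" direction is false. *)

theory Defs
  imports Complex_Main "Jordan_Normal_Form.Matrix"
begin

text \<open>
  An edge is a list of distinct vertices. An edge and its reversal are the same edge; an edge set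
  may contain either orientation of an edge, or both, and all notions below are insensitive to
  this choice. Accordingly, two members \<open>e\<close>, \<open>f\<close> of an edge set are distinct edges iff
  \<open>f \<notin> {e, rev e}\<close>.
\<close>

definition semigraph :: "'a set \<Rightarrow> 'a list set \<Rightarrow> bool" where
  "semigraph V E \<longleftrightarrow>
     finite V \<and> V \<noteq> {} \<and>
     (\<forall>e\<in>E. 2 \<le> length e \<and> distinct e \<and> set e \<subseteq> V) \<and>
     (\<forall>e\<in>E. \<forall>f\<in>E. f \<notin> {e, rev e} \<longrightarrow> card (set e \<inter> set f) \<le> 1)"

text \<open>
  The two vertices \<open>x\<close>, \<open>y\<close> may coincide, so every vertex of a connected semigraph lies on an edge.
\<close>

definition semigraph_connected :: "'a set \<Rightarrow> 'a list set \<Rightarrow> bool" where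
  "semigraph_connected V E \<longleftrightarrow>
     (\<forall>x\<in>V. \<forall>y\<in>V. \<exists>es. es \<noteq> [] \<and> set es \<subseteq> E \<and> x \<in> set (hd es) \<and> y \<in> set (last es) \<and>
        (\<forall>j. Suc j < length es \<longrightarrow> card (set (es ! j) \<inter> set (es ! Suc j)) = 1))"

definition end_vertex_of :: "'a list \<Rightarrow> 'a \<Rightarrow> bool" where
  "end_vertex_of e x \<longleftrightarrow> x = hd e \<or> x = last e"

definition middle_vertex_of :: "'a list \<Rightarrow> 'a \<Rightarrow> bool" where
  "middle_vertex_of e x \<longleftrightarrow> (\<exists>i. 0 < i \<and> i < length e - 1 \<and> x = e ! i)"

definition pure_end :: "'a list set \<Rightarrow> 'a \<Rightarrow> bool" where
  "pure_end E x \<longleftrightarrow> (\<forall>e\<in>E. x \<in> set e \<longrightarrow> end_vertex_of e x)"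

definition middle_end :: "'a list set \<Rightarrow> 'a \<Rightarrow> bool" where
  "middle_end E x \<longleftrightarrow>
     (\<exists>e\<in>E. \<exists>f\<in>E. f \<notin> {e, rev e} \<and> middle_vertex_of e x \<and> end_vertex_of f x)"

definition full_edge :: "'a list set \<Rightarrow> 'a list \<Rightarrow> bool" where
  "full_edge E e \<longleftrightarrow> e \<in> E \<and> pure_end E (hd e) \<and> pure_end E (last e)"

definition quarter_edge :: "'a list set \<Rightarrow> 'a list \<Rightarrow> bool" where
  "quarter_edge E e \<longleftrightarrow> e \<in> E \<and> length e = 2 \<and> middle_end E (hd e) \<and> middle_end E (last e)"

definition half_edge :: "'a list set \<Rightarrow> 'a list \<Rightarrow> bool" where
  "half_edge E e \<longleftrightarrow> e \<in> E \<and>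
     (length e > 2 \<and> (middle_end E (hd e) \<or> middle_end E (last e)) \<or>
      length e = 2 \<and> (middle_end E (hd e) \<and> pure_end E (last e) \<or>
                       pure_end E (hd e) \<and> middle_end E (last e)))"

definition partial_half_edge :: "'a list set \<Rightarrow> 'a \<Rightarrow> 'a \<Rightarrow> bool" where
  "partial_half_edge E x y \<longleftrightarrow> (\<exists>e. half_edge E e \<and>
     (length e > 2 \<and> middle_end E (hd e) \<and> {x, y} = {e ! 0, e ! 1} \<or>
      length e > 2 \<and> middle_end E (last e) \<and> {x, y} = {e ! (length e - 2), e ! (length e - 1)} \<or>
      length e = 2 \<and> {x, y} = set e))"

definition quarter_pair :: "'a list set \<Rightarrow> 'a \<Rightarrow> 'a \<Rightarrow> bool" where
  "quarter_pair E x y \<longleftrightarrow> (\<exists>e. quarter_edge E e \<and> {x, y} = set e)"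

definition position :: "'a list \<Rightarrow> 'a \<Rightarrow> nat" where
  "position e x = (THE i. i < length e \<and> e ! i = x)"

definition edge_dist :: "'a list \<Rightarrow> 'a \<Rightarrow> 'a \<Rightarrow> real" where
  "edge_dist e x y = \<bar>real (position e x) - real (position e y)\<bar>"

text \<open>
  In a semigraph two different vertices lie on at most one edge (up to reversal), and reversal does
  not change distances, so the value described by \<open>THE\<close> is unique.
\<close>

definition adjacency_entry :: "'a list set \<Rightarrow> 'a \<Rightarrow> 'a \<Rightarrow> real" where
  "adjacency_entry E x y =
     (if partial_half_edge E x y then 1/2
      else if quarter_pair E x y then 1/4
      else if x \<noteq> y \<and> (\<exists>e. (full_edge E e \<or> half_edge E e) \<and> x \<in> set e \<and> y \<in> set e)
      then (THE d. \<exists>e. (full_edge E e \<or> half_edge E e) \<and> x \<in> set e \<and> y \<in> set e \<and>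
                       d = edge_dist e x y)
      else 0)"

text \<open>The vertices are listed as \<open>v 0, \<dots>, v (n - 1)\<close>; matrix indices start at 0.\<close>

definition adjacency_matrix :: "nat \<Rightarrow> (nat \<Rightarrow> 'a) \<Rightarrow> 'a list set \<Rightarrow> real mat" where
  "adjacency_matrix n v E = mat n n (\<lambda>(i, j). adjacency_entry E (v i) (v j))"

text \<open>
  Semigraphs are connected by convention. Vertices are natural numbers without loss of generality,
  since vertex sets are finite.
\<close>

definition semigraphical :: "real mat \<Rightarrow> bool" where
  "semigraphical A \<longleftrightarrow>
     (\<exists>(V :: nat set) E v. semigraph V E \<and> semigraph_connected V E \<and>
        bij_betw v {0..<card V} V \<and> A = adjacency_matrix (card V) v E)"

text \<open>The submatrix of \<open>A\<close> with rows and columns indexed by \<open>set u\<close>, arranged in the order of \<open>u\<close>.\<close>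

definition ordered_submatrix :: "'b mat \<Rightarrow> nat list \<Rightarrow> 'b mat" where
  "ordered_submatrix A u = mat (length u) (length u) (\<lambda>(p, q). A $$ (u ! p, u ! q))"

text \<open>
  Rows and columns are numbered from 0. An end vertex of an edge in \<open>E\<close> is either a pure end vertex
  or a middle end vertex, so \<open>\<mu>1\<close> and \<open>\<mu>2\<close> cover both cases.
\<close>

definition edge_submatrix :: "'a list set \<Rightarrow> 'a list \<Rightarrow> real mat" where
  "edge_submatrix E u =
     (let r = length u;
          \<mu>1 = (if middle_end E (hd u) then 1/2 else 1);
          \<mu>2 = (if middle_end E (last u) then 1/2 else 1)
      in mat r r (\<lambda>(p, q).
           if p = q then 0
           else if quarter_edge E u then 1/4
           else if r = 2 then (if pure_end E (hd u) \<and> pure_end E (last u) then 1 else 1/2)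
           else if {p, q} = {0, 1} then \<mu>1
           else if {p, q} = {r - 2, r - 1} then \<mu>2
           else \<bar>real p - real q\<bar>))"

text \<open>
  In the characterization of semigraphical matrices, the vertex sets \<open>e i\<close> with their orderings \<open>u i\<close>
  must form a connected semigraph, and \<open>A\<close> must vanish at every pair not contained in one of the
  \<open>e i\<close>. Neither can be dropped. With \<open>{0, 1}\<close>, \<open>{2, 3}\<close> and \<open>A\<close> block diagonal, all edge submatrices
  are right but \<open>A\<close> belongs to no connected semigraph; with \<open>{0, 1}\<close>, \<open>{1, 2}\<close> and the entry \<open>1/2\<close>
  at \<open>(0, 2)\<close> and \<open>(2, 0)\<close>, it belongs to no semigraph at all.
\<close>

end

theory Submission
  imports Defs
begin

text \<open>
  Two different vertices lie on at most one edge up to reversal, so the adjacency entry of two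
  vertices of an edge is determined by their positions on that edge and by which of its ends are
  middle end vertices: the adjacency matrix restricted to an edge is its edge submatrix, and off
  the edges it vanishes.
\<close>

section \<open>Uniqueness of the edge through two vertices\<close>

lemma semigraph_edgeD:
  assumes "semigraph V E" "e \<in> E"
  shows "2 \<le> length e" "distinct e" "set e \<subseteq> V" "e \<noteq> []"
  using assms unfolding semigraph_def by fastforce+

text \<open>Two common vertices already exceed the permitted intersection size. This collapses the
  existential quantifiers and descriptions over edges in the definitions below to a single edge and
  its reversal.\<close>

lemma semigraph_edge_unique:
  assumes G: "semigraph V E" and ef: "e \<in> E" "f \<in> E"
    and "x \<noteq> y" "x \<in> set e" "y \<in> set e" "x \<in> set f" "y \<in> set f"
  shows "f \<in> {e, rev e}"
proof (rule ccontr)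
  assume "f \<notin> {e, rev e}"
  then have "card (set e \<inter> set f) \<le> 1"
    using G ef unfolding semigraph_def by blast
  moreover have "card {x, y} \<le> card (set e \<inter> set f)"
    by (rule card_mono) (use assms in auto)
  ultimately show False using \<open>x \<noteq> y\<close> by simp
qed

text \<open>An edge has two different vertices, so its vertex set determines it up to orientation.
  Hence passing to vertex sets loses nothing but the orientation.\<close>

lemma semigraph_edge_unique_set:
  assumes G: "semigraph V E" and ef: "e \<in> E" "f \<in> E" and S: "set e = set f"
  shows "f \<in> {e, rev e}"
proof -
  have len: "2 \<le> length e" and d: "distinct e" using semigraph_edgeD[OF G ef(1)] by auto
  then have "e ! 0 \<noteq> e ! 1" by (subst nth_eq_iff_index_eq) auto
  moreover have "e ! 0 \<in> set e" "e ! 1 \<in> set e" using len by (auto intro!: nth_mem)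
  ultimately show ?thesis using semigraph_edge_unique[OF G ef] S by metis
qed

section \<open>Vertex types and edge types, and their behaviour under reversal\<close>

lemma end_vertex_of_rev [simp]: "end_vertex_of (rev e) x = end_vertex_of e x"
  unfolding end_vertex_of_def by (metis hd_rev last_rev)

lemma middle_vertex_of_imp_not_end:
  assumes "distinct e" "middle_vertex_of e x"
  shows "\<not> end_vertex_of e x"
proof -
  obtain i where i: "0 < i" "i < length e - 1" "x = e ! i"
    using assms(2) unfolding middle_vertex_of_def by blast
  then have ne: "e \<noteq> []" by auto
  have "e ! i \<noteq> e ! 0" "e ! i \<noteq> e ! (length e - 1)"
    using i assms(1) by (subst nth_eq_iff_index_eq; auto)+
  then show ?thesis
    using ne i(3) by (simp add: end_vertex_of_def hd_conv_nth last_conv_nth)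
qed

lemma not_end_imp_middle_vertex_of:
  assumes "x \<in> set e" "\<not> end_vertex_of e x"
  shows "middle_vertex_of e x"
proof -
  obtain i where i: "i < length e" "x = e ! i"
    using assms(1) by (metis in_set_conv_nth)
  then have ne: "e \<noteq> []" by auto
  have "i \<noteq> 0" "i \<noteq> length e - 1"
    using assms(2) i ne by (metis end_vertex_of_def hd_conv_nth last_conv_nth)+
  then show ?thesis using i unfolding middle_vertex_of_def
    by (intro exI[of _ i]) auto
qed

lemma middle_vertex_of_iff:
  assumes "distinct e"
  shows "middle_vertex_of e x \<longleftrightarrow> x \<in> set e \<and> \<not> end_vertex_of e x"
  using middle_vertex_of_imp_not_end[OF assms] not_end_imp_middle_vertex_of
  unfolding middle_vertex_of_def by fastforce

text \<open>That the two edges differ is automatic: on a list of distinct vertices no vertex is both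
  middle and end, and reversal preserves ends. In this form each quantifier ranges over a property
  invariant under reversal.\<close>

lemma middle_end_iff:
  assumes G: "semigraph V E"
  shows "middle_end E x \<longleftrightarrow>
    (\<exists>e\<in>E. x \<in> set e \<and> \<not> end_vertex_of e x) \<and> (\<exists>f\<in>E. end_vertex_of f x)"
  using semigraph_edgeD(2)[OF G] middle_vertex_of_iff
  unfolding middle_end_def by (metis end_vertex_of_rev insertE singletonD)

text \<open>The given edge supplies the end occurrence, so the only question left is whether some
  edge has \<open>x\<close> in its middle.\<close>

lemma pure_end_iff_not_middle_end:
  assumes G: "semigraph V E" and "e \<in> E" "end_vertex_of e x"
  shows "pure_end E x \<longleftrightarrow> \<not> middle_end E x"
  using assms unfolding middle_end_iff[OF G] pure_end_def by blast

lemma pure_end_hd_last: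
  assumes G: "semigraph V E" and "e \<in> E"
  shows "pure_end E (hd e) \<longleftrightarrow> \<not> middle_end E (hd e)"
    and "pure_end E (last e) \<longleftrightarrow> \<not> middle_end E (last e)"
  by (rule pure_end_iff_not_middle_end[OF assms], simp add: end_vertex_of_def)+

text \<open>At the ends of an edge, pure end and middle end are complementary, so for two vertices
  "exactly one" becomes an inequality of truth values. The other branch means at least three
  vertices.\<close>

lemma half_edge_iff:
  assumes G: "semigraph V E"
  shows "half_edge E e \<longleftrightarrow> e \<in> E \<and>
    (if length e = 2 then middle_end E (hd e) \<noteq> middle_end E (last e)
     else middle_end E (hd e) \<or> middle_end E (last e))"
  using semigraph_edgeD(1)[OF G, of e] pure_end_hd_last[OF G, of e]
  unfolding half_edge_def by (cases "e \<in> E") auto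

lemma full_edge_iff:
  assumes G: "semigraph V E"
  shows "full_edge E e \<longleftrightarrow> e \<in> E \<and> \<not> middle_end E (hd e) \<and> \<not> middle_end E (last e)"
  using pure_end_hd_last[OF G, of e] unfolding full_edge_def by auto

text \<open>The three edge types exhaust all edges, so the distance clause of
  \<open>adjacency_entry\<close> ranges over the edges that are not quarter edges.\<close>

lemma full_or_half_edge_iff:
  assumes G: "semigraph V E"
  shows "full_edge E e \<or> half_edge E e \<longleftrightarrow> e \<in> E \<and> \<not> quarter_edge E e"
  unfolding full_edge_iff[OF G] half_edge_iff[OF G] quarter_edge_def by auto

lemma half_edge_rev:
  assumes "semigraph V E" "e \<in> E" "half_edge E (rev e)"
  shows "half_edge E e"
  using assms unfolding half_edge_iff[OF assms(1)] by (auto simp: hd_rev last_rev split: if_splits)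

lemma quarter_edge_rev:
  assumes "e \<in> E" "quarter_edge E (rev e)"
  shows "quarter_edge E e"
  using assms unfolding quarter_edge_def by (auto simp: hd_rev last_rev)

section \<open>Positions and distances on an edge\<close>

lemma position_nth [simp]:
  assumes "distinct e" "p < length e"
  shows "position e (e ! p) = p"
  unfolding position_def using assms
  by (intro the_equality) (auto simp: nth_eq_iff_index_eq)

lemma edge_dist_nth:
  assumes "distinct e" "p < length e" "q < length e"
  shows "edge_dist e (e ! p) (e ! q) = \<bar>real p - real q\<bar>"
  using assms by (simp add: edge_dist_def)

text \<open>Reversal sends position \<open>i\<close> to \<open>length e - Suc i\<close>, which
  changes a difference of positions only in sign.\<close>

lemma edge_dist_rev_nth:
  assumes "distinct e" "p < length e" "q < length e"
  shows "edge_dist (rev e) (e ! p) (e ! q) = \<bar>real p - real q\<bar>"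
proof -
  have "position (rev e) (e ! i) = length e - Suc i" if "i < length e" for i
    using position_nth[of "rev e" "length e - Suc i"] that assms(1) by (simp add: rev_nth)
  then show ?thesis using assms by (simp add: edge_dist_def of_nat_diff)
qed

lemma doubleton_nth_eq_iff:
  assumes "distinct e" "p < length e" "q < length e" "i < length e" "j < length e"
  shows "{e ! p, e ! q} = {e ! i, e ! j} \<longleftrightarrow> {p, q} = {i, j}"
  using assms by (auto simp: doubleton_eq_iff nth_eq_iff_index_eq)

lemma distinct_nth_pair_eq_set:
  assumes "length e = 2" "p < length e" "q < length e" "p \<noteq> q"
  shows "{e ! p, e ! q} = set e"
proof -
  obtain a b where "e = [a, b]" using assms(1) by (auto simp: numeral_2_eq_2 length_Suc_conv)
  then show ?thesis using assms by (auto simp: less_Suc_eq numeral_2_eq_2)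
qed

section \<open>Adjacency entries on and off an edge\<close>

text \<open>Any witness of a partial half edge contains both vertices, hence is \<open>e\<close> or
  its reversal, and the condition on the witness is the same for both. So the pair can be tested by
  positions on \<open>e\<close> alone.\<close>

lemma partial_half_edge_nth_iff:
  assumes G: "semigraph V E" and e: "e \<in> E"
    and pq: "p < length e" "q < length e" "p \<noteq> q"
  shows "partial_half_edge E (e ! p) (e ! q) \<longleftrightarrow> half_edge E e \<and>
    (length e > 2 \<and> middle_end E (hd e) \<and> {p, q} = {0, 1} \<or>
     length e > 2 \<and> middle_end E (last e) \<and> {p, q} = {length e - 2, length e - 1} \<or>
     length e = 2)"
    (is "?L \<longleftrightarrow> half_edge E e \<and> ?R")
proof -
  have d: "distinct e" and len: "2 \<le> length e" using semigraph_edgeD[OF G e] by auto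
  have ne: "e ! p \<noteq> e ! q" using d pq by (simp add: nth_eq_iff_index_eq)
  define B where "B f \<longleftrightarrow> length f > 2 \<and> middle_end E (hd f) \<and> {e ! p, e ! q} = {f ! 0, f ! 1} \<or>
      length f > 2 \<and> middle_end E (last f) \<and> {e ! p, e ! q} = {f ! (length f - 2), f ! (length f - 1)} \<or>
      length f = 2 \<and> {e ! p, e ! q} = set f" for f
  have B_e: "B e \<longleftrightarrow> ?R"
    unfolding B_def using d pq len distinct_nth_pair_eq_set[of e p q]
    by (subst (1 2) doubleton_nth_eq_iff) auto
  \<comment> \<open>Reversal swaps the first pair with the last pair and \<open>hd\<close> with
    \<open>last\<close>, hence interchanges the first two disjuncts of \<open>B\<close>.\<close>
  have B_rev: "B (rev e) \<longleftrightarrow> B e"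
  proof (cases "length e = 2")
    case True
    then show ?thesis by (simp add: B_def)
  next
    case False
    have "rev e ! 0 = e ! (length e - 1)" "rev e ! 1 = e ! (length e - 2)"
      "rev e ! (length e - 2) = e ! 1" "rev e ! (length e - 1) = e ! 0"
      using len by (subst rev_nth; fastforce intro: arg_cong[of _ _ "(!) e"])+
    then have "{rev e ! 0, rev e ! 1} = {e ! (length e - 2), e ! (length e - 1)}"
      "{rev e ! (length e - 2), rev e ! (length e - 1)} = {e ! 0, e ! 1}"
      by (simp_all only: insert_commute)
    then show ?thesis using False
      unfolding B_def length_rev hd_rev last_rev set_rev by metis
  qed
  have "f \<in> {e, rev e}" if "half_edge E f" "B f" for f
  proof -
    have f: "f \<in> E" using that(1) by (simp add: half_edge_def)
    have "{e ! p, e ! q} \<subseteq> set f"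
      using that(2) semigraph_edgeD[OF G f] unfolding B_def by (elim disjE conjE) auto
    then show ?thesis using semigraph_edge_unique[OF G e f ne] pq by auto
  qed
  moreover have "?L \<longleftrightarrow> (\<exists>f. half_edge E f \<and> B f)"
    unfolding partial_half_edge_def B_def ..
  ultimately have "?L \<longleftrightarrow> half_edge E e \<and> B e"
    using B_rev half_edge_rev[OF G e] by (metis insertE singletonD)
  then show ?thesis unfolding B_e .
qed

lemma quarter_pair_nth_iff:
  assumes G: "semigraph V E" and e: "e \<in> E"
    and pq: "p < length e" "q < length e" "p \<noteq> q"
  shows "quarter_pair E (e ! p) (e ! q) \<longleftrightarrow> quarter_edge E e"
proof
  have ne: "e ! p \<noteq> e ! q"
    using semigraph_edgeD[OF G e] pq by (simp add: nth_eq_iff_index_eq)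
  assume "quarter_pair E (e ! p) (e ! q)"
  then obtain f where f: "quarter_edge E f" "{e ! p, e ! q} = set f"
    unfolding quarter_pair_def by blast
  then have "f \<in> {e, rev e}"
    using semigraph_edge_unique[OF G e _ ne, of f] pq by (auto simp: quarter_edge_def)
  then show "quarter_edge E e" using f(1) quarter_edge_rev[OF e] by blast
next
  assume "quarter_edge E e"
  moreover from this have "{e ! p, e ! q} = set e"
    using distinct_nth_pair_eq_set pq unfolding quarter_edge_def by blast
  ultimately show "quarter_pair E (e ! p) (e ! q)" unfolding quarter_pair_def by blast
qed

text \<open>The distance clause demands \<open>x \<noteq> y\<close> explicitly; the other two
  clauses equate \<open>{x, y}\<close> with a set of two different vertices of an edge.\<close>

lemma adjacency_entry_same [simp]:
  assumes G: "semigraph V E"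
  shows "adjacency_entry E x x = 0"
proof -
  have "{x, x} \<noteq> {e ! i, e ! j}" if "e \<in> E" "i < length e" "j < length e" "i \<noteq> j" for e i j
    using semigraph_edgeD(2)[OF G that(1)] that by (auto simp: nth_eq_iff_index_eq)
  \<comment> \<open>The two instances are the first and the last pair of an edge, the candidates for
    partial half edges with more than two vertices.\<close>
  from this[of _ 0 1] this[of e "length e - 2" "length e - 1" for e]
  have "{x, x} \<noteq> {e ! 0, e ! 1}" "{x, x} \<noteq> {e ! (length e - 2), e ! (length e - 1)}"
    if "e \<in> E" for e
    using semigraph_edgeD[OF G that] that by auto
  moreover have "{x, x} \<noteq> set e" if "e \<in> E" for e
  proof
    assume "{x, x} = set e"
    then have "card (set e) = 1" by (metis insert_absorb2 is_singletonI is_singleton_altdef)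
    then show False using semigraph_edgeD[OF G that] by (simp add: distinct_card)
  qed
  ultimately have "\<not> partial_half_edge E x x" "\<not> quarter_pair E x x"
    unfolding partial_half_edge_def quarter_pair_def half_edge_def quarter_edge_def by blast+
  then show ?thesis by (simp add: adjacency_entry_def)
qed

text \<open>Every nonzero clause of the definition exhibits an edge through both vertices.\<close>

lemma adjacency_entry_not_joined:
  assumes G: "semigraph V E" and no: "\<And>e. e \<in> E \<Longrightarrow> \<not> {x, y} \<subseteq> set e"
  shows "adjacency_entry E x y = 0"
proof -
  have "\<not> partial_half_edge E x y"
  proof
    assume "partial_half_edge E x y"
    then obtain e where e: "e \<in> E" and
      xy: "{x, y} = {e ! 0, e ! 1} \<or> {x, y} = {e ! (length e - 2), e ! (length e - 1)} \<or> {x, y} = set e"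
      unfolding partial_half_edge_def half_edge_def by blast
    show False using xy no[OF e] semigraph_edgeD[OF G e] by (elim disjE) auto
  qed
  moreover have "\<not> quarter_pair E x y"
    using no unfolding quarter_pair_def quarter_edge_def by blast
  ultimately show ?thesis
    using no unfolding adjacency_entry_def full_edge_def half_edge_def by auto
qed

text \<open>Both sides are case distinctions on positions and on the type of the two ends. The
  values \<open>1\<close> for an end pair at a pure end vertex agree with the distance clause,
  because consecutive positions have distance 1.\<close>

lemma adjacency_entry_nth:
  assumes G: "semigraph V E" and e: "e \<in> E" and pq: "p < length e" "q < length e"
  shows "adjacency_entry E (e ! p) (e ! q) = edge_submatrix E e $$ (p, q)"
proof (cases "p = q")
  case True
  then show ?thesis using G pq by (simp add: edge_submatrix_def Let_def)
next
  case False
  note d = semigraph_edgeD(2)[OF G e]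
  have ne: "e ! p \<noteq> e ! q" using d pq False by (simp add: nth_eq_iff_index_eq)
  have dist: "adjacency_entry E (e ! p) (e ! q) = \<bar>real p - real q\<bar>"
    if "\<not> partial_half_edge E (e ! p) (e ! q)" "\<not> quarter_edge E e"
  proof -
    let ?P = "\<lambda>f. (full_edge E f \<or> half_edge E f) \<and> e ! p \<in> set f \<and> e ! q \<in> set f"
    have "?P e"
      using that(2) e pq unfolding full_or_half_edge_iff[OF G] by auto
    moreover have "edge_dist f (e ! p) (e ! q) = \<bar>real p - real q\<bar>" if "?P f" for f
    proof -
      have "f \<in> {e, rev e}"
        using semigraph_edge_unique[OF G e _ ne, of f] that pq
        unfolding full_or_half_edge_iff[OF G] by auto
      then show ?thesis using edge_dist_nth edge_dist_rev_nth d pq by blast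
    qed
    ultimately have "(THE x. \<exists>f. (full_edge E f \<or> half_edge E f) \<and> e ! p \<in> set f \<and> e ! q \<in> set f
        \<and> x = edge_dist f (e ! p) (e ! q)) = \<bar>real p - real q\<bar>"
      by (intro the_equality) metis+
    then show ?thesis
      using that ne \<open>?P e\<close> quarter_pair_nth_iff[OF G e pq False]
      unfolding adjacency_entry_def by auto
  qed
  note partial = partial_half_edge_nth_iff[OF G e pq False]
  note quarter = quarter_pair_nth_iff[OF G e pq False]
  show ?thesis
  proof (cases "length e = 2")
    case True
    then have "\<bar>real p - real q\<bar> = 1" using pq False by (auto simp: less_2_cases_iff)
    then show ?thesis
      using True False pq dist partial quarter e
      by (auto simp: edge_submatrix_def Let_def half_edge_iff[OF G] pure_end_hd_last[OF G e]
          adjacency_entry_def quarter_edge_def)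
  next
    case F: False
    then have len: "length e > 2" using semigraph_edgeD(1)[OF G e] by simp
    then have nq: "\<not> quarter_edge E e" by (simp add: quarter_edge_def)
    have "\<bar>real p - real q\<bar> = 1"
      if "{p, q} = {0, 1} \<or> {p, q} = {length e - 2, length e - 1}"
      using that len by (auto simp: doubleton_eq_iff)
    \<comment> \<open>With at least three vertices the two end pairs are different, so testing for
      the first pair before the last one cannot hide a value.\<close>
    moreover have "{0, 1} \<noteq> {length e - 2, length e - 1}"
      using len by (auto simp: doubleton_eq_iff)
    moreover have "partial_half_edge E (e ! p) (e ! q) \<longleftrightarrow>
        middle_end E (hd e) \<and> {p, q} = {0, 1} \<or>
        middle_end E (last e) \<and> {p, q} = {length e - 2, length e - 1}"
      unfolding partial using len e by (auto simp: half_edge_iff[OF G])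
    moreover have "adjacency_entry E (e ! p) (e ! q) =
        (if partial_half_edge E (e ! p) (e ! q) then 1/2 else \<bar>real p - real q\<bar>)"
      using dist nq by (auto simp: adjacency_entry_def)
    moreover have "edge_submatrix E e $$ (p, q) =
        (if {p, q} = {0, 1} then if middle_end E (hd e) then 1/2 else 1
         else if {p, q} = {length e - 2, length e - 1} then if middle_end E (last e) then 1/2 else 1
         else \<bar>real p - real q\<bar>)"
      using pq False F nq by (simp add: edge_submatrix_def Let_def)
    ultimately show ?thesis by (auto simp del: One_nat_def)
  qed
qed

section \<open>Symmetry and possible values of adjacency entries\<close>

lemma adjacency_entry_sym:
  assumes G: "semigraph V E"
  shows "adjacency_entry E x y = adjacency_entry E y x"
proof -
  have "partial_half_edge E x y = partial_half_edge E y x" "quarter_pair E x y = quarter_pair E y x"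
    unfolding partial_half_edge_def quarter_pair_def by (simp_all add: insert_commute)
  moreover have "edge_dist e x y = edge_dist e y x" for e
    by (simp add: edge_dist_def abs_minus_commute)
  ultimately show ?thesis 
    unfolding adjacency_entry_def by (intro if_cong arg_cong[where f = The] ext) metis+
qed

text \<open>Distances on an edge are below its length, and an edge has at most \<open>card V\<close>
  vertices because they are distinct.\<close>

lemma adjacency_entry_range:
  assumes G: "semigraph V E"
  shows "adjacency_entry E x y \<in> {0, 1/4, 1/2} \<union> real ` {1..card V - 1}"
proof (cases "x \<noteq> y \<and> (\<exists>e\<in>E. {x, y} \<subseteq> set e)")
  case False
  then show ?thesis using G adjacency_entry_not_joined[OF G, of x y] by auto
next
  case True
  then obtain e where e: "e \<in> E" "x \<in> set e" "y \<in> set e" by auto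
  then obtain p q where pq: "p < length e" "q < length e" "x = e ! p" "y = e ! q"
    by (metis in_set_conv_nth)
  with True have "p \<noteq> q" by auto
  have "finite V" using G by (simp add: semigraph_def)
  then have len: "length e \<le> card V"
    using semigraph_edgeD[OF G e(1)] card_mono[of V "set e"] distinct_card[of e] by auto
  have nat: "real k \<in> real ` {1..card V - 1}" if "1 \<le> k" "k < length e" for k
    using that len by auto
  have "\<bar>real p - real q\<bar> = real (if p < q then q - p else p - q)" by auto
  also have "\<dots> \<in> real ` {1..card V - 1}" using pq \<open>p \<noteq> q\<close> by (intro nat) auto
  finally have "\<bar>real p - real q\<bar> \<in> real ` {1..card V - 1}" .
  moreover have "1 \<in> real ` {1..card V - 1}"
    using nat[of 1] semigraph_edgeD(1)[OF G e(1)] by simp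
  ultimately show ?thesis
    using pq by (auto simp: adjacency_entry_nth[OF G e(1)] edge_submatrix_def Let_def)
qed

section \<open>Renaming vertices and choosing orientations\<close>

lemma end_vertex_of_map:
  assumes "inj_on w V" "set e \<subseteq> V" "e \<noteq> []" "x \<in> V"
  shows "end_vertex_of (map w e) (w x) \<longleftrightarrow> end_vertex_of e x"
  using assms unfolding end_vertex_of_def
  by (metis hd_in_set inj_on_eq_iff last_in_set last_map list.map_sel(1) subsetD)

text \<open>\<open>E'\<close> arises from \<open>E\<close> by an injective renaming \<open>w\<close>
  followed by possibly discarding one of two opposite orientations: \<open>sub\<close> forbids new
  edges, \<open>reps\<close> keeps at least one orientation of each. This is the passage from
  vertices to matrix indices.\<close>

locale semigraph_relabelling =
  fixes V :: "'a set" and E :: "'a list set" and w :: "'a \<Rightarrow> 'b" and E' :: "'b list set"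
  assumes semigraph: "semigraph V E"
    and inj: "inj_on w V"
    and sub: "E' \<subseteq> map w ` E"
    and reps: "\<And>f. f \<in> E \<Longrightarrow> map w f \<in> E' \<or> rev (map w f) \<in> E'"
begin

lemmas edgeD = semigraph_edgeD[OF semigraph]

lemma relabelled_edge:
  assumes "f \<in> E"
  obtains f' where "f' \<in> E'" "set f' = w ` set f"
  using reps[OF assms] by (metis set_map set_rev)

lemma semigraph_relabelled: "semigraph (w ` V) E'"
  unfolding semigraph_def
proof (intro conjI ballI impI)
  show "finite (w ` V)" "w ` V \<noteq> {}" using semigraph by (auto simp: semigraph_def)
next
  fix e' assume "e' \<in> E'"
  then obtain e where e: "e \<in> E" "e' = map w e" using sub by blast
  show "2 \<le> length e'" "distinct e'" "set e' \<subseteq> w ` V"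
    using edgeD[OF e(1)] e(2) inj by (auto simp: distinct_map intro: inj_on_subset)
next
  fix e' f' assume "e' \<in> E'" "f' \<in> E'" and ne: "f' \<notin> {e', rev e'}"
  then obtain e f where e: "e \<in> E" "e' = map w e" and f: "f \<in> E" "f' = map w f"
    using sub by blast
  have "f \<notin> {e, rev e}" using ne e f by (auto simp: rev_map)
  then have "card (set e \<inter> set f) \<le> 1" using semigraph e f unfolding semigraph_def by blast
  moreover have "set e' \<inter> set f' = w ` (set e \<inter> set f)"
    using e f edgeD(3) inj_on_image_Int[OF inj, of "set e" "set f"] by auto
  ultimately show "card (set e' \<inter> set f') \<le> 1"
    by (metis card_image_le finite_Int finite_set le_trans)
qed

lemma end_vertex_of_relabelled:
  assumes "e \<in> E" "x \<in> V"
  shows "end_vertex_of (map w e) (w x) \<longleftrightarrow> end_vertex_of e x"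
  using end_vertex_of_map[OF inj] edgeD[OF assms(1)] assms(2) by blast

lemma mem_relabelled:
  assumes "e \<in> E" "x \<in> V"
  shows "w x \<in> set (map w e) \<longleftrightarrow> x \<in> set e"
  using inj_on_image_mem_iff[OF inj assms(2) edgeD(3)[OF assms(1)]] by simp

text \<open>Discarding an orientation does not affect an existential statement about a property
  invariant under reversal, and \<open>middle_end_iff\<close> is built from two such
  statements.\<close>

lemma middle_end_relabelled:
  assumes x: "x \<in> V"
  shows "middle_end E' (w x) \<longleftrightarrow> middle_end E x"
proof -
  have "(\<exists>e'\<in>E'. P e') \<longleftrightarrow> (\<exists>e\<in>E. P (map w e))" if "\<And>f. P (rev f) = P f" for P
    using sub reps that by (metis (no_types, lifting) imageE subset_iff)
  from this[of "\<lambda>f. w x \<in> set f \<and> \<not> end_vertex_of f (w x)"] this[of "\<lambda>f. end_vertex_of f (w x)"]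
  show ?thesis
    unfolding middle_end_iff[OF semigraph] middle_end_iff[OF semigraph_relabelled]
    using end_vertex_of_relabelled[OF _ x] mem_relabelled[OF _ x] by (simp del: set_map)
qed

text \<open>An edge submatrix depends only on the length of the edge and the types of its two ends,
  all of which survive the renaming.\<close>

lemma edge_submatrix_relabelled:
  assumes e: "e \<in> E" and e': "map w e \<in> E'"
  shows "edge_submatrix E' (map w e) = edge_submatrix E e"
proof -
  have ne: "e \<noteq> []" and V: "hd e \<in> V" "last e \<in> V" using edgeD[OF e] by auto
  then have m: "middle_end E' (hd (map w e)) = middle_end E (hd e)"
    "middle_end E' (last (map w e)) = middle_end E (last e)"
    by (simp_all add: hd_map last_map middle_end_relabelled)
  moreover from this have "quarter_edge E' (map w e) = quarter_edge E e"
    using e e' by (simp add: quarter_edge_def)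
  ultimately show ?thesis
    unfolding edge_submatrix_def Let_def pure_end_hd_last[OF semigraph e]
      pure_end_hd_last[OF semigraph_relabelled e'] length_map by (simp only:)
qed

lemma semigraph_connected_relabelled:
  assumes "semigraph_connected V E"
  shows "semigraph_connected (w ` V) E'"
  unfolding semigraph_connected_def
proof (intro ballI)
  fix x' y' assume "x' \<in> w ` V" "y' \<in> w ` V"
  then obtain x y where xy: "x \<in> V" "y \<in> V" "x' = w x" "y' = w y" by blast
  obtain es where es: "es \<noteq> []" "set es \<subseteq> E" "x \<in> set (hd es)" "y \<in> set (last es)"
    "\<And>j. Suc j < length es \<Longrightarrow> card (set (es ! j) \<inter> set (es ! Suc j)) = 1"
    using assms xy unfolding semigraph_connected_def by blast
  \<comment> \<open>Each edge of the walk is replaced by a surviving representative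
    \<open>g f\<close>. Only vertex sets matter for a walk, and injectivity of \<open>w\<close>
    preserves the size of the intersections.\<close>
  have "\<forall>f\<in>E. \<exists>f'. f' \<in> E' \<and> set f' = w ` set f" using relabelled_edge by metis
  then obtain g where g: "\<And>f. f \<in> E \<Longrightarrow> g f \<in> E' \<and> set (g f) = w ` set f"
    by metis
  have "card (set (map g es ! j) \<inter> set (map g es ! Suc j)) = 1" if j: "Suc j < length es" for j
  proof -
    have E: "es ! j \<in> E" "es ! Suc j \<in> E" using es(2) j by auto
    then have "set (g (es ! j)) \<inter> set (g (es ! Suc j)) = w ` (set (es ! j) \<inter> set (es ! Suc j))"
      using g edgeD(3) inj_on_image_Int[OF inj] by simp
    moreover have "inj_on w (set (es ! j) \<inter> set (es ! Suc j))"
      using inj edgeD(3)[OF E(1)] by (blast intro: inj_on_subset)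
    ultimately show ?thesis using es(5)[OF j] j by (simp add: card_image)
  qed
  moreover have "hd es \<in> E" "last es \<in> E" using es(1,2) by auto
  then have "x' \<in> set (hd (map g es))" "y' \<in> set (last (map g es))"
    using es(1,3,4) g xy by (auto simp: hd_map last_map)
  moreover have "set (map g es) \<subseteq> E'" using g es(2) by auto
  ultimately show "\<exists>es. es \<noteq> [] \<and> set es \<subseteq> E' \<and> x' \<in> set (hd es) \<and> y' \<in> set (last es) \<and>
      (\<forall>j. Suc j < length es \<longrightarrow> card (set (es ! j) \<inter> set (es ! Suc j)) = 1)"
    using es(1) by (intro exI[of _ "map g es"]) simp
qed

end

section \<open>Enumerating the edges and covering the vertices\<close>

lemma semigraph_finite:
  assumes "semigraph V E"
  shows "finite E"
proof (rule finite_subset)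
  show "E \<subseteq> {e. set e \<subseteq> V \<and> length e \<le> card V}"
    using assms by (auto simp: semigraph_def) (metis card_mono distinct_card)
  show "finite {e. set e \<subseteq> V \<and> length e \<le> card V}"
    using assms by (intro finite_lists_length_le) (simp add: semigraph_def)
qed

text \<open>
  An edge set may contain both orientations of an edge, while the vertex sets of a decomposition are
  pairwise almost disjoint; hence one orientation is chosen per vertex set.
\<close>

lemma semigraph_edge_enumeration:
  assumes G: "semigraph V E"
  obtains m and c :: "nat \<Rightarrow> 'a list" where "c ` {1..m} \<subseteq> E"
    "\<And>f. f \<in> E \<Longrightarrow> \<exists>i\<in>{1..m}. f \<in> {c i, rev (c i)}"
    "\<And>i j. i \<in> {1..m} \<Longrightarrow> j \<in> {1..m} \<Longrightarrow> i \<noteq> j \<Longrightarrow> card (set (c i) \<inter> set (c j)) \<le> 1"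
proof -
  define S where "S = set ` E"
  have "finite S" unfolding S_def using semigraph_finite[OF G] by blast
  then obtain h where h: "bij_betw h {1..card S} S" using ex_bij_betw_nat_finite_1 by blast
  then have "\<forall>i\<in>{1..card S}. \<exists>e\<in>E. set e = h i"
    unfolding S_def bij_betw_def by (metis imageE imageI)
  then obtain c where c: "\<And>i. i \<in> {1..card S} \<Longrightarrow> c i \<in> E \<and> set (c i) = h i"
    by metis
  have neq: "h i \<noteq> h j" if "i \<in> {1..card S}" "j \<in> {1..card S}" "i \<noteq> j" for i j
    using h that by (meson bij_betw_imp_inj_on inj_onD)
  show ?thesis
  proof (rule that[of c "card S"])
    show "c ` {1..card S} \<subseteq> E" using c by blast
    show "\<exists>i\<in>{1..card S}. f \<in> {c i, rev (c i)}" if "f \<in> E" for f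
    proof -
      have "set f \<in> h ` {1..card S}" using h that by (auto simp: S_def bij_betw_def)
      then obtain i where i: "i \<in> {1..card S}" "set f = h i" by (rule imageE)
      then have "f \<in> {c i, rev (c i)}"
        using semigraph_edge_unique_set[OF G _ that, of "c i"] c[OF i(1)] by simp
      then show ?thesis using i(1) by (rule bexI)
    qed
    show "card (set (c i) \<inter> set (c j)) \<le> 1"
      if "i \<in> {1..card S}" "j \<in> {1..card S}" "i \<noteq> j" for i j
    proof -
      \<comment> \<open>Different indices carry different vertex sets, so the chosen edges differ
        even up to reversal.\<close>
      have "c j \<notin> {c i, rev (c i)}" using c[OF that(1)] c[OF that(2)] neq[OF that] by auto
      then show ?thesis using G c[OF that(1)] c[OF that(2)] unfolding semigraph_def by blast
    qed
  qed
qed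

lemma semigraph_connected_covered:
  assumes "semigraph V E" "semigraph_connected V E"
  shows "V = (\<Union>e\<in>E. set e)"
proof
  show "V \<subseteq> (\<Union>e\<in>E. set e)"
  proof
    fix x assume "x \<in> V"
    then obtain es where "es \<noteq> []" "set es \<subseteq> E" "x \<in> set (hd es)"
      using assms(2) unfolding semigraph_connected_def by blast
    then show "x \<in> (\<Union>e\<in>E. set e)" using hd_in_set by blast
  qed
  show "(\<Union>e\<in>E. set e) \<subseteq> V" using assms(1) by (auto simp: semigraph_def)
qed

section \<open>Translation between matrices and semigraphs\<close>

text \<open>The index list \<open>u\<close> is kept apart from the vertex list \<open>e\<close>,
  since the rows of \<open>A\<close> carry indices while \<open>E\<close> lives on the original
  vertices.\<close>

lemma ordered_submatrix_adjacency:
  assumes "semigraph V E" "e \<in> E" "length u = length e"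
    and "\<And>p q. p < length e \<Longrightarrow> q < length e \<Longrightarrow> A $$ (u ! p, u ! q) = adjacency_entry E (e ! p) (e ! q)"
  shows "ordered_submatrix A u = edge_submatrix E e"
proof (rule eq_matI)
  show "dim_row (ordered_submatrix A u) = dim_row (edge_submatrix E e)"
    "dim_col (ordered_submatrix A u) = dim_col (edge_submatrix E e)"
    using assms(3) by (simp_all add: ordered_submatrix_def edge_submatrix_def Let_def)
  fix p q assume "p < dim_row (edge_submatrix E e)" "q < dim_col (edge_submatrix E e)"
  then have pq: "p < length e" "q < length e" by (simp_all add: edge_submatrix_def Let_def)
  then show "ordered_submatrix A u $$ (p, q) = edge_submatrix E e $$ (p, q)"
    using assms adjacency_entry_nth[OF assms(1,2)] by (simp add: ordered_submatrix_def)
qed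

theorem theorem2p9:
  fixes A :: "real mat" and n :: nat
  assumes "A \<in> carrier_mat n n" and "1 \<le> n"
  shows "semigraphical A \<longleftrightarrow>
    ((\<forall>i<n. \<forall>j<n. A $$ (i, j) \<in> {0, 1/4, 1/2} \<union> real ` {1..n - 1} \<and> A $$ (i, j) = A $$ (j, i)) \<and>
     (\<forall>i<n. A $$ (i, i) = 0)) \<and>
    (\<exists>m (e :: nat \<Rightarrow> nat set) (u :: nat \<Rightarrow> nat list).
       {0..<n} = (\<Union>i\<in>{1..m}. e i) \<and>
       (\<forall>i\<in>{1..m}. 2 \<le> card (e i)) \<and>
       (\<forall>i\<in>{1..m}. \<forall>j\<in>{1..m}. i \<noteq> j \<longrightarrow> card (e i \<inter> e j) \<le> 1) \<and>
       (\<forall>i\<in>{1..m}. distinct (u i) \<and> set (u i) = e i \<and>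
          ordered_submatrix A (u i) = edge_submatrix (u ` {1..m}) (u i)) \<and>
       semigraph_connected {0..<n} (u ` {1..m}) \<and>
       (\<forall>i<n. \<forall>j<n. (\<forall>k\<in>{1..m}. \<not> {i, j} \<subseteq> e k) \<longrightarrow> A $$ (i, j) = 0))"
  (is "_ \<longleftrightarrow> ?C1 \<and> (\<exists>m e u. ?D m e u)")
proof
  assume "semigraphical A"
  then obtain V :: "nat set" and E v where G: "semigraph V E" and con: "semigraph_connected V E"
    and v: "bij_betw v {0..<card V} V" and A: "A = adjacency_matrix (card V) v E"
    unfolding semigraphical_def by (elim exE conjE)
  have n: "card V = n" using assms(1) A by (auto simp: adjacency_matrix_def)
  have entry: "A $$ (i, j) = adjacency_entry E (v i) (v j)" if "i < n" "j < n" for i j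
    using that A n by (simp add: adjacency_matrix_def)
  have ?C1
    using adjacency_entry_range[OF G] adjacency_entry_sym[OF G] G
    by (simp add: entry n del: Un_insert_left)
  moreover have "\<exists>m e u. ?D m e u"
  proof -
    \<comment> \<open>The inverse of the listing \<open>v\<close> sends each vertex to its matrix
      index, turning edges into lists of indices.\<close>
    define w where "w = inv_into {0..<n} v"
    have w: "bij_betw w V {0..<n}" using v n bij_betw_inv_into unfolding w_def by metis
    have vw: "v (w x) = x" if "x \<in> V" for x
      using that v n bij_betw_inv_into_right unfolding w_def by metis
    have wv: "w (v i) = i" "v i \<in> V" if "i < n" for i
      using that v n by (auto simp: w_def bij_betw_inv_into_left bij_betwE)
    have wn: "w x < n" if "x \<in> V" for x using that w bij_betwE by fastforce
    obtain m and c :: "nat \<Rightarrow> nat list" where c: "c ` {1..m} \<subseteq> E"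
      "\<And>f. f \<in> E \<Longrightarrow> \<exists>i\<in>{1..m}. f \<in> {c i, rev (c i)}"
      "\<And>i j. i \<in> {1..m} \<Longrightarrow> j \<in> {1..m} \<Longrightarrow> i \<noteq> j \<Longrightarrow> card (set (c i) \<inter> set (c j)) \<le> 1"
      using semigraph_edge_enumeration[OF G] by metis
    define u where "u i = map w (c i)" for i
    interpret semigraph_relabelling V E w "u ` {1..m}"
    proof
      show "u ` {1..m} \<subseteq> map w ` E" using c(1) by (auto simp: u_def)
      show "map w f \<in> u ` {1..m} \<or> rev (map w f) \<in> u ` {1..m}" if f: "f \<in> E" for f
        using c(2)[OF f] by (auto simp: u_def rev_map)
    qed (use G w in \<open>auto simp: bij_betw_def\<close>)
    have im: "w ` V = {0..<n}" using w by (simp add: bij_betw_def)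
    note G' = semigraph_relabelled[unfolded im]
    have con': "semigraph_connected {0..<n} (u ` {1..m})"
      using semigraph_connected_relabelled[OF con] im by simp
    show ?thesis
    proof (intro exI conjI ballI impI allI)
      show "{0..<n} = (\<Union>i\<in>{1..m}. set (u i))"
        using semigraph_connected_covered[OF G' con'] by simp
      show "semigraph_connected {0..<n} (u ` {1..m})" by (rule con')
    next
      fix i assume i: "i \<in> {1..m}"
      then have ui: "u i \<in> u ` {1..m}" and ci: "c i \<in> E" using c(1) by auto
      show "distinct (u i)" "2 \<le> card (set (u i))" "set (u i) = set (u i)"
        using semigraph_edgeD[OF G' ui] by (auto simp: distinct_card)
      have "A $$ (u i ! p, u i ! q) = adjacency_entry E (c i ! p) (c i ! q)"
        if "p < length (c i)" "q < length (c i)" for p q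
      proof -
        have "c i ! p \<in> V" "c i ! q \<in> V" using that edgeD(3)[OF ci] by auto
        then show ?thesis using that by (simp add: u_def entry wn vw)
      qed
      then have "ordered_submatrix A (u i) = edge_submatrix E (c i)"
        using ordered_submatrix_adjacency[OF G ci] by (simp add: u_def)
      then show "ordered_submatrix A (u i) = edge_submatrix (u ` {1..m}) (u i)"
        using edge_submatrix_relabelled[OF ci] ui by (simp add: u_def)
    next
      fix i j assume ij: "i \<in> {1..m}" "j \<in> {1..m}" "i \<noteq> j"
      then have "c i \<in> E" "c j \<in> E" using c(1) by auto
      then have "set (u i) \<inter> set (u j) = w ` (set (c i) \<inter> set (c j))"
        using edgeD(3) inj_on_image_Int[OF inj] by (simp add: u_def)
      then show "card (set (u i) \<inter> set (u j)) \<le> 1"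
        using c(3)[OF ij] card_image_le[of "set (c i) \<inter> set (c j)" w] by simp
    next
      fix i j assume ij: "i < n" "j < n" and no: "\<forall>k\<in>{1..m}. \<not> {i, j} \<subseteq> set (u k)"
      \<comment> \<open>An edge through both vertices would have a representative \<open>c k\<close>
        with the same vertex set, and \<open>u k\<close> would contain both indices.\<close>
      have "\<not> {v i, v j} \<subseteq> set f" if f: "f \<in> E" for f
      proof
        assume vf: "{v i, v j} \<subseteq> set f"
        obtain k where k: "k \<in> {1..m}" "set (c k) = set f" using c(2)[OF f] by auto
        then have "{w (v i), w (v j)} \<subseteq> set (u k)" using vf by (auto simp: u_def)
        then show False using no k(1) ij wv by auto
      qed
      then show "A $$ (i, j) = 0"
        using entry[OF ij] adjacency_entry_not_joined[OF G] by simp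
    qed
  qed
  ultimately show "?C1 \<and> (\<exists>m e u. ?D m e u)" ..
next
  assume "?C1 \<and> (\<exists>m e u. ?D m e u)"
  then have "\<exists>m e u. ?D m e u" by (rule conjunct2)
  then obtain m e u where D: "?D m e u" by (elim exE)
  have cover: "{0..<n} = (\<Union>i\<in>{1..m}. e i)"
    and card: "\<forall>i\<in>{1..m}. 2 \<le> card (e i)"
    and meet: "\<forall>i\<in>{1..m}. \<forall>j\<in>{1..m}. i \<noteq> j \<longrightarrow> card (e i \<inter> e j) \<le> 1"
    and u: "\<forall>i\<in>{1..m}. distinct (u i) \<and> set (u i) = e i \<and>
          ordered_submatrix A (u i) = edge_submatrix (u ` {1..m}) (u i)"
    and con: "semigraph_connected {0..<n} (u ` {1..m})"
    and zero: "\<forall>i<n. \<forall>j<n. (\<forall>k\<in>{1..m}. \<not> {i, j} \<subseteq> e k) \<longrightarrow> A $$ (i, j) = 0"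
    using D by - (elim conjE, assumption)+
  \<comment> \<open>For the converse the indices themselves serve as vertices, and the given
    orderings as edges.\<close>
  let ?E = "u ` {1..m}"
  have G: "semigraph {0..<n} ?E"
    unfolding semigraph_def
  proof (intro conjI ballI impI)
    fix f assume "f \<in> ?E"
    then obtain i where i: "i \<in> {1..m}" "f = u i" by blast
    show "2 \<le> length f" "distinct f" "set f \<subseteq> {0..<n}"
      using bspec[OF u i(1)] bspec[OF card i(1)] i cover distinct_card[of f] by auto
  next
    fix f g assume "f \<in> ?E" "g \<in> ?E" "g \<notin> {f, rev f}"
    then obtain i j where "i \<in> {1..m}" "f = u i" "j \<in> {1..m}" "g = u j" "i \<noteq> j" by blast
    then show "card (set f \<inter> set g) \<le> 1" using meet u by metis
  qed (use assms(2) in auto)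
  have "A = adjacency_matrix n id ?E"
  proof (rule eq_matI)
    fix i j assume "i < dim_row (adjacency_matrix n id ?E)" "j < dim_col (adjacency_matrix n id ?E)"
    then have ij: "i < n" "j < n" by (simp_all add: adjacency_matrix_def)
    have "A $$ (i, j) = adjacency_entry ?E i j"
    \<comment> \<open>On a common edge both entries are read off the same edge submatrix; off all
      edges both vanish, \<open>A\<close> by the vanishing condition.\<close>
    proof (cases "\<exists>k\<in>{1..m}. {i, j} \<subseteq> e k")
      case True
      then obtain k where k: "k \<in> {1..m}" "i \<in> set (u k)" "j \<in> set (u k)" using u by auto
      then obtain p q where pq: "p < length (u k)" "q < length (u k)" "i = u k ! p" "j = u k ! q"
        by (metis in_set_conv_nth)
      then have "A $$ (i, j) = ordered_submatrix A (u k) $$ (p, q)"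
        by (simp add: ordered_submatrix_def)
      then show ?thesis using adjacency_entry_nth[OF G, of "u k" p q] k u pq by simp
    next
      case False
      then have "\<not> {i, j} \<subseteq> set f" if "f \<in> ?E" for f using u that by blast
      then have "adjacency_entry ?E i j = 0" by (rule adjacency_entry_not_joined[OF G])
      then show ?thesis using zero ij False by simp
    qed
    then show "A $$ (i, j) = adjacency_matrix n id ?E $$ (i, j)"
      using ij by (simp add: adjacency_matrix_def)
  qed (use assms(1) in \<open>auto simp: adjacency_matrix_def\<close>)
  then show "semigraphical A"
    unfolding semigraphical_def using G con
    by (intro exI[of _ "{0..<n}"] exI[of _ ?E] exI[of _ id]) simp
qed

end
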